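(* Octants are cover-decomposable; precisely: let $O\subset\mathbb{R}^3$ be an octant, let $S\subseteq\mathbb{R}^3$ be any subset, and let $\mathcal{P}=\{P_i : i\in I\}$ be a finite collection of translates of $O$ that is a $12$-fold covering of $S$. Then $\mathcal{P}$ can be decomposed into two coverings of $S$, i.e. there is a partition $I=I_1\sqcup I_2$ such that each of $\{P_i : i\in I_1\}$ and $\{P_i: i\in I_2\}$ is a covering of $S$.
   Context: An octant in $\mathbb{R}^3$ is a translate of a set $\{(x_1,x_2,x_3)\in\mathbb{R}^3 : \varepsilon_i x_i\le 0 \text{ for } i=1,2,3\}$ with $\varepsilon_1,\varepsilon_2,\varepsilon_3\in\{-1,1\}$, or of the corresponding open set (all three inequalities strict). A collection $\{P_i : i\in I\}$ of sets is an $m$-fold covering of a set $S$ if every point of $S$ is contained in at least $m$ members of the collection (i.e. in $P_i$ for at least $m$ indices $i$); a $1$-fold covering is called a covering. A set $P\subset\mathbb{R}^d$ is called cover-decomposable if there is a constant $m=m(P)$ such that every $m$-fold covering of any subset of $\mathbb{R}^d$ with a finite number of translates of $P$ can be decomposed into two coverings of the same subset. *)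

theory Defs
  imports "HOL-Analysis.Analysis"
begin

definition octant :: "(real^3) set \<Rightarrow> bool" where
  "octant Q \<longleftrightarrow>
     (\<exists>(\<epsilon>::real^3) v. (\<forall>i. \<epsilon> $ i \<in> {-1, 1}) \<and>
        (Q = (+) v ` {x. \<forall>i. \<epsilon> $ i * x $ i \<le> 0} \<or>
         Q = (+) v ` {x. \<forall>i. \<epsilon> $ i * x $ i < 0}))"

definition translate_of :: "(real^'d) set \<Rightarrow> (real^'d) set \<Rightarrow> bool" where
  "translate_of Q R \<longleftrightarrow> (\<exists>v. R = (+) v ` Q)"

(* Multiplicity is counted by indices, so members may coincide as sets. Witnessing index sets
   are used instead of card {i \<in> I. x \<in> P i}, which would be 0 when that set is infinite. *)
definition fold_covering :: "nat \<Rightarrow> 'a set \<Rightarrow> 'i set \<Rightarrow> ('i \<Rightarrow> 'a set) \<Rightarrow> bool" where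
  "fold_covering m S I P \<longleftrightarrow>
     (\<forall>x\<in>S. \<exists>J\<subseteq>I. finite J \<and> card J = m \<and> (\<forall>j\<in>J. x \<in> P j))"

abbreviation covering :: "'a set \<Rightarrow> 'i set \<Rightarrow> ('i \<Rightarrow> 'a set) \<Rightarrow> bool" where
  "covering \<equiv> fold_covering 1"

definition decomposes_into_two_coverings :: "'a set \<Rightarrow> 'i set \<Rightarrow> ('i \<Rightarrow> 'a set) \<Rightarrow> bool" where
  "decomposes_into_two_coverings S I P \<longleftrightarrow>
     (\<exists>I1 I2. I1 \<union> I2 = I \<and> I1 \<inter> I2 = {} \<and> covering S I1 P \<and> covering S I2 P)"

(* A definition cannot quantify over the index type; every finite family can be indexed by a
   finite set of natural numbers. *)
definition cover_decomposable :: "(real^'d) set \<Rightarrow> bool" where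
  "cover_decomposable Q \<longleftrightarrow>
     (\<exists>m. \<forall>S (I::nat set) P. finite I \<longrightarrow> (\<forall>i\<in>I. translate_of Q (P i)) \<longrightarrow>
        fold_covering m S I P \<longrightarrow> decomposes_into_two_coverings S I P)"

end

theory Submission
  imports Defs
begin

text \<open>Dually, one has to two-colour finitely many points of space so that every translate of a
  fixed octant with at least 12 points sees both colours. The points are inserted in the order of
  their third coordinate, so that only planar quadrants (\<open>wedge\<close>) of the points inserted so far
  matter. Colours are decided lazily: there is a set \<open>B\<close> of free points, forming an antichain, such
  that every colouring of \<open>B\<close> extends to a suitable colouring of all points. Besides there is a
  set \<open>S\<close> of staircase points such that no wedge missing \<open>S\<close> contains four free points, a wedge
  with three points of \<open>S\<close> is bichromatic, and so is any wedge with a point outside \<open>S \<union> B\<close>. A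
  monochromatic wedge then has at most two staircase points; its free points lie in three wedges
  missing \<open>S\<close>, so there are at most nine of them.

  Whenever a wedge \<open>W\<close> missing \<open>S\<close> has free points \<open>z1, z2, z3, z4\<close>, ordered from left to right,
  the inner points \<open>z2\<close> and \<open>z3\<close> become staircase points, coloured oppositely to \<open>z1\<close> and \<open>z4\<close>. A
  wedge with \<open>z2\<close> or \<open>z3\<close> and an older staircase point reaches beyond \<open>W\<close> to the top or to
  the right, and hence contains both \<open>z1, z2\<close> or both \<open>z3, z4\<close>.\<close>

section \<open>Lower sets and two-coloured sets\<close>

text \<open>Lower sets include strict and non-strict half-lines alike, so open and closed octants
  need no separate treatment, and points may share coordinates.\<close>

definition lower :: "('a \<Rightarrow> 'b::linorder) \<Rightarrow> 'a set \<Rightarrow> bool" where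
  "lower f X \<longleftrightarrow> (\<forall>i\<in>X. \<forall>j. f j \<le> f i \<longrightarrow> j \<in> X)"

definition bichromatic :: "('a \<Rightarrow> bool) \<Rightarrow> 'a set \<Rightarrow> bool" where
  "bichromatic \<kappa> A \<longleftrightarrow> (\<exists>i\<in>A. \<exists>j\<in>A. \<kappa> i \<noteq> \<kappa> j)"

lemma bichromatic_mono:
  assumes "bichromatic \<kappa> A" "A \<subseteq> A'" "\<And>i. i \<in> A \<Longrightarrow> \<kappa>' i = \<kappa> i"
  shows "bichromatic \<kappa>' A'"
  using assms unfolding bichromatic_def by blast

lemma lower_less: "lower f X \<Longrightarrow> i \<in> X \<Longrightarrow> j \<notin> X \<Longrightarrow> f i < f j"
  unfolding lower_def by (meson not_le)

lemma lower_Collect_le: "lower f {i. f i \<le> c}"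
  unfolding lower_def by auto

lemma lower_Collect_less: "lower f {i. f i < c}"
  unfolding lower_def by auto

lemma four_increasing:
  fixes f :: "'a \<Rightarrow> 'b::linorder"
  assumes "finite A" "inj_on f A" "4 \<le> card A"
  obtains a b c d where "a \<in> A" "b \<in> A" "c \<in> A" "d \<in> A" "f a < f b" "f b < f c" "f c < f d"
proof -
  define l where "l = sorted_list_of_set (f ` A)"
  have len: "4 \<le> length l"
    using assms by (simp add: l_def card_image)
  have lt: "l ! i < l ! j" if "i < j" "j < 4" for i j
    using strict_sorted_list_of_set[of "f ` A"] that len
    by (auto simp: l_def[symmetric] sorted_wrt_nth_less)
  have "l ! i \<in> f ` A" if "i < 4" for i
    using that len assms(1) nth_mem[of i l] by (simp add: l_def)
  moreover define g where "g i = inv_into A f (l ! i)" for i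
  ultimately have g: "g i \<in> A \<and> f (g i) = l ! i" if "i < 4" for i
    using that by (simp add: inv_into_into f_inv_into_f)
  show thesis
    by (rule that[of "g 0" "g 1" "g 2" "g 3"]) (use g lt in auto)
qed

section \<open>Planar wedges and lazily coloured point sets\<close>

locale planar_points =
  fixes x :: "'a \<Rightarrow> 'b::linorder" and y :: "'a \<Rightarrow> 'c::linorder"
begin

definition wedge :: "'a set \<Rightarrow> bool" where
  "wedge W \<longleftrightarrow> (\<exists>X Y. lower x X \<and> lower y Y \<and> W = X \<inter> Y)"

definition below :: "'a \<Rightarrow> 'a \<Rightarrow> bool" where
  "below p q \<longleftrightarrow> x p \<le> x q \<and> y p \<le> y q"

text \<open>The first clause leaves wedges with only free points unconstrained. The threshold 3
  exceeds the number of staircase points that one split creates, so reaching it always takes an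
  older one.\<close>

definition suitable :: "'a set \<Rightarrow> 'a set set \<Rightarrow> 'a set \<Rightarrow> 'a set \<Rightarrow> ('a \<Rightarrow> bool) \<Rightarrow> bool" where
  "suitable P H S B \<kappa> \<longleftrightarrow>
     (\<forall>W. wedge W \<longrightarrow> W \<inter> (P - S - B) \<noteq> {} \<or> 3 \<le> card (W \<inter> S) \<longrightarrow> bichromatic \<kappa> (W \<inter> P)) \<and>
     (\<forall>A\<in>H. bichromatic \<kappa> A)"

text \<open>\<open>H\<close> records the sets already known to be bichromatic, that is, the large wedges
  of all earlier moments.\<close>

definition state :: "'a set \<Rightarrow> 'a set set \<Rightarrow> 'a set \<Rightarrow> 'a set \<Rightarrow> bool" where
  "state P H S B \<longleftrightarrow>
     finite P \<and> S \<subseteq> P \<and> B \<subseteq> P \<and> S \<inter> B = {} \<and>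
     (\<forall>b\<in>B. \<forall>a\<in>S \<union> B. a \<noteq> b \<longrightarrow> \<not> below a b) \<and>
     (\<forall>\<beta>. \<exists>\<kappa>. (\<forall>b\<in>B. \<kappa> b = \<beta> b) \<and> suitable P H S B \<kappa>)"

definition sparse :: "'a set \<Rightarrow> 'a set \<Rightarrow> bool" where
  "sparse S B \<longleftrightarrow> (\<forall>W. wedge W \<longrightarrow> W \<inter> S = {} \<longrightarrow> card (W \<inter> B) \<le> 3)"

lemma below_in_wedge: "wedge W \<Longrightarrow> below p q \<Longrightarrow> q \<in> W \<Longrightarrow> p \<in> W"
  unfolding wedge_def lower_def below_def by auto

lemma stateI:
  assumes "finite P" "S \<subseteq> P" "B \<subseteq> P" "S \<inter> B = {}"
    and "\<And>a b. a \<in> S \<union> B \<Longrightarrow> b \<in> B \<Longrightarrow> a \<noteq> b \<Longrightarrow> \<not> below a b"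
    and "\<And>\<beta>. \<exists>\<kappa>. (\<forall>b\<in>B. \<kappa> b = \<beta> b) \<and> suitable P H S B \<kappa>"
  shows "state P H S B"
  unfolding state_def using assms by (intro conjI ballI impI allI) simp_all

lemma state_sets:
  assumes "state P H S B"
  shows "finite P" "S \<subseteq> P" "B \<subseteq> P" "S \<inter> B = {}"
  using assms unfolding state_def by simp_all

lemma state_antichain:
  assumes "state P H S B" "a \<in> S \<union> B" "b \<in> B" "a \<noteq> b"
  shows "\<not> below a b"
  using assms unfolding state_def by simp

lemma state_extend:
  assumes "state P H S B"
  obtains \<kappa> where "\<And>b. b \<in> B \<Longrightarrow> \<kappa> b = \<beta> b" "suitable P H S B \<kappa>"
proof -
  have "\<exists>\<kappa>. (\<forall>b\<in>B. \<kappa> b = \<beta> b) \<and> suitable P H S B \<kappa>"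
    using assms unfolding state_def by simp
  then show thesis using that by blast
qed

lemma suitable_exceptional:
  assumes "suitable P H S B \<kappa>" "wedge W" "p \<in> W" "p \<in> P" "p \<notin> S" "p \<notin> B"
  shows "bichromatic \<kappa> (W \<inter> P)"
  using assms unfolding suitable_def by blast

lemma suitable_card:
  assumes "suitable P H S B \<kappa>" "wedge W" "3 \<le> card (W \<inter> S)"
  shows "bichromatic \<kappa> (W \<inter> P)"
  using assms unfolding suitable_def by blast

lemma suitable_history:
  assumes "suitable P H S B \<kappa>" "A \<in> H"
  shows "bichromatic \<kappa> A"
  using assms unfolding suitable_def by blast

section \<open>Inserting a point\<close>

text \<open>If some \<open>s\<close> in \<open>S \<union> B\<close> lies below \<open>r\<close>, the
  colour opposite to \<open>s\<close> settles every wedge through \<open>r\<close>. Otherwise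
  \<open>r\<close> becomes free, and the free points above it give up their freedom to be coloured
  oppositely to \<open>r\<close>. Members of \<open>H\<close> avoid \<open>r\<close>, so they keep
  their colours.\<close>

lemma state_insert:
  assumes st: "state P H S B" and r: "r \<notin> P" and H: "\<And>A. A \<in> H \<Longrightarrow> A \<subseteq> P"
  shows "\<exists>S' B'. state (insert r P) H S' B'"
proof (cases "\<exists>s\<in>S \<union> B. below s r")
  case True
  then obtain s where s: "s \<in> S \<union> B" "below s r" by blast
  have sP: "s \<in> P" using s state_sets[OF st] by blast
  have "\<exists>\<kappa>'. (\<forall>b\<in>B. \<kappa>' b = \<beta> b) \<and> suitable (insert r P) H S B \<kappa>'" for \<beta>
  proof -
    obtain \<kappa> where \<kappa>: "\<And>b. b \<in> B \<Longrightarrow> \<kappa> b = \<beta> b" "suitable P H S B \<kappa>"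
      using state_extend[OF st] by blast
    define \<kappa>' where "\<kappa>' = \<kappa>(r := \<not> \<kappa> s)"
    have same: "\<kappa>' i = \<kappa> i" if "i \<in> P" for i
      using that r by (auto simp: \<kappa>'_def)
    have up: "bichromatic \<kappa>' (W \<inter> insert r P)" if "bichromatic \<kappa> (W \<inter> P)" for W
      by (rule bichromatic_mono[OF that]) (use same in auto)
    have "bichromatic \<kappa>' (W \<inter> insert r P)"
      if W: "wedge W" and "W \<inter> (insert r P - S - B) \<noteq> {} \<or> 3 \<le> card (W \<inter> S)" for W
    proof (cases "r \<in> W")
      case True
      then have "s \<in> W" using W s below_in_wedge by blast
      moreover have "\<kappa>' s \<noteq> \<kappa>' r" using same[OF sP] by (simp add: \<kappa>'_def)
      ultimately show ?thesis
        using True sP unfolding bichromatic_def by blast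
    next
      case False
      with that \<kappa>(2) have "bichromatic \<kappa> (W \<inter> P)" unfolding suitable_def by blast
      then show ?thesis by (rule up)
    qed
    moreover have "bichromatic \<kappa>' A" if "A \<in> H" for A
      by (rule bichromatic_mono[OF suitable_history[OF \<kappa>(2) that]]) (use same H that in auto)
    ultimately have "suitable (insert r P) H S B \<kappa>'"
      unfolding suitable_def by blast
    moreover have "\<forall>b\<in>B. \<kappa>' b = \<beta> b"
      using \<kappa>(1) same state_sets[OF st] by blast
    ultimately show ?thesis by blast
  qed
  moreover have "finite (insert r P)" "S \<subseteq> insert r P" "B \<subseteq> insert r P" "S \<inter> B = {}"
    using state_sets[OF st] by auto
  ultimately have "state (insert r P) H S B"
    using state_antichain[OF st] by (intro stateI) simp_all
  then show ?thesis by blast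
next
  case False
  define K where "K = {b \<in> B. below r b}"
  \<comment> \<open>The antichain condition survives: it forbids points below free ones only, so
    staircase points above \<open>r\<close> do no harm.\<close>
  define B' where "B' = insert r (B - K)"
  have "\<exists>\<kappa>'. (\<forall>b\<in>B'. \<kappa>' b = \<beta> b) \<and> suitable (insert r P) H S B' \<kappa>'" for \<beta>
  proof -
    \<comment> \<open>The colour demanded of \<open>r\<close> is known before the old state is
      extended, so its opposite can be prescribed on \<open>K\<close>.\<close>
    obtain \<kappa> where \<kappa>: "\<And>b. b \<in> B \<Longrightarrow> \<kappa> b = (if b \<in> K then \<not> \<beta> r else \<beta> b)" "suitable P H S B \<kappa>"
      using state_extend[OF st, of "\<lambda>b. if b \<in> K then \<not> \<beta> r else \<beta> b"] by blast
    define \<kappa>' where "\<kappa>' = \<kappa>(r := \<beta> r)"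
    have same: "\<kappa>' i = \<kappa> i" if "i \<in> P" for i
      using that r by (auto simp: \<kappa>'_def)
    have up: "bichromatic \<kappa>' (W \<inter> insert r P)" if "bichromatic \<kappa> (W \<inter> P)" for W
      by (rule bichromatic_mono[OF that]) (use same in auto)
    have "bichromatic \<kappa>' (W \<inter> insert r P)"
      if W: "wedge W" and "W \<inter> (insert r P - S - B') \<noteq> {} \<or> 3 \<le> card (W \<inter> S)" for W
    \<comment> \<open>The points of \<open>K\<close> are the only ones that newly lie outside
      \<open>S \<union> B'\<close>.\<close>
    proof (cases "W \<inter> K = {}")
      case True
      with that \<kappa>(2) have "bichromatic \<kappa> (W \<inter> P)" unfolding suitable_def B'_def by blast
      then show ?thesis by (rule up)
    next
      case False
      then obtain b where b: "b \<in> W" "b \<in> K" by blast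
      then have "r \<in> W" using W below_in_wedge unfolding K_def by blast
      moreover have "b \<in> P" "b \<in> B" using b state_sets[OF st] unfolding K_def by blast+
      moreover have "\<kappa>' b \<noteq> \<kappa>' r" using \<kappa>(1) b \<open>b \<in> B\<close> same[OF \<open>b \<in> P\<close>] by (simp add: \<kappa>'_def)
      ultimately show ?thesis using b unfolding bichromatic_def by blast
    qed
    moreover have "bichromatic \<kappa>' A" if "A \<in> H" for A
      by (rule bichromatic_mono[OF suitable_history[OF \<kappa>(2) that]]) (use same H that in auto)
    ultimately have "suitable (insert r P) H S B' \<kappa>'"
      unfolding suitable_def by blast
    moreover have "\<forall>b\<in>B'. \<kappa>' b = \<beta> b"
      using \<kappa>(1) by (auto simp: \<kappa>'_def B'_def)
    ultimately show ?thesis by blast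
  qed
  moreover have "finite (insert r P)" "S \<subseteq> insert r P" "B' \<subseteq> insert r P" "S \<inter> B' = {}"
    using state_sets[OF st] r unfolding B'_def by auto
  moreover have "\<not> below a b" if "a \<in> S \<union> B'" "b \<in> B'" "a \<noteq> b" for a b
    using state_antichain[OF st, of a b] that False unfolding B'_def K_def by blast
  ultimately have "state (insert r P) H S B'"
    by (intro stateI)
  then show ?thesis by blast
qed

section \<open>Enforcing sparsity\<close>

text \<open>Afterwards \<open>W\<close> meets the staircase set and no longer violates
  \<open>sparse\<close>. The drop of \<open>card B\<close> makes repeated splitting
  terminate.\<close>

lemma state_split:
  assumes st: "state P H S B" and W: "wedge W" "W \<inter> S = {}" and card: "4 \<le> card (W \<inter> B)"
  shows "\<exists>S' B'. state P H S' B' \<and> card B' < card B"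
proof -
  have fin: "finite P" "finite B" "finite S"
    using state_sets[OF st] finite_subset by blast+
  note anti = state_antichain[OF st]
  \<comment> \<open>Two points with equal \<open>x\<close> would be comparable under
    \<open>below\<close>.\<close>
  have inj: "inj_on x (W \<inter> B)"
    unfolding inj_on_def using anti unfolding below_def by (metis IntD2 UnI2 linear order_refl)
  obtain z1 z2 z3 z4 where
    z: "z1 \<in> W \<inter> B" "z2 \<in> W \<inter> B" "z3 \<in> W \<inter> B" "z4 \<in> W \<inter> B"
    and xz: "x z1 < x z2" "x z2 < x z3" "x z3 < x z4"
    by (rule four_increasing[OF _ inj card]) (use fin in auto)
  have descend: "y q < y p" if "p \<in> B" "q \<in> B" "x p < x q" for p q
    using anti[of p q] that unfolding below_def by force
  have yz: "y z2 < y z1" "y z3 < y z2" "y z4 < y z3"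
    using descend z xz by blast+
  have ne: "z1 \<noteq> z2" "z1 \<noteq> z3" "z4 \<noteq> z2" "z4 \<noteq> z3" "z2 \<noteq> z3" using xz by auto
  obtain X Y where XY: "lower x X" "lower y Y" "W = X \<inter> Y"
    using W unfolding wedge_def by blast
  define S' where "S' = insert z2 (insert z3 S)"
  define B' where "B' = B - {z2, z3}"
  have zP: "z1 \<in> P" "z2 \<in> P" "z3 \<in> P" "z4 \<in> P"
    using z state_sets[OF st] by blast+
  have pairs: "z1 \<in> V \<and> z2 \<in> V \<or> z3 \<in> V \<and> z4 \<in> V"
    if V: "wedge V" and q: "q \<in> V" "q \<in> S" and zV: "z2 \<in> V \<or> z3 \<in> V" for V q
  proof -
    obtain X' Y' where V': "lower x X'" "lower y Y'" "V = X' \<inter> Y'"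
      using V unfolding wedge_def by blast
    have "q \<notin> X \<or> q \<notin> Y" using W(2) q XY(3) by blast
    then show ?thesis
    proof
      assume "q \<notin> X"
      then have "x z3 \<le> x q" "x z4 \<le> x q"
        using lower_less[OF XY(1)] z XY(3) by (auto intro: less_imp_le)
      then have "z3 \<in> X'" "z4 \<in> X'" using V' q unfolding lower_def by auto
      \<comment> \<open>Heights decrease from \<open>z1\<close> to \<open>z4\<close>, so whichever
        of \<open>z2\<close>, \<open>z3\<close> lies in \<open>V\<close> forces both
        \<open>z3\<close> and \<open>z4\<close> into \<open>Y'\<close>. The other case is
        symmetric.\<close>
      moreover have "z3 \<in> Y'" "z4 \<in> Y'"
        using zV V' yz unfolding lower_def by (meson IntD2 less_imp_le order_trans)+
      ultimately show ?thesis using V' by blast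
    next
      assume "q \<notin> Y"
      then have "y z1 \<le> y q" "y z2 \<le> y q"
        using lower_less[OF XY(2)] z XY(3) by (auto intro: less_imp_le)
      then have "z1 \<in> Y'" "z2 \<in> Y'" using V' q unfolding lower_def by auto
      moreover have "z1 \<in> X'" "z2 \<in> X'"
        using zV V' xz unfolding lower_def by (meson IntD1 less_imp_le order_trans)+
      ultimately show ?thesis using V' by blast
    qed
  qed
  have "\<exists>\<kappa>. (\<forall>b\<in>B'. \<kappa> b = \<beta> b) \<and> suitable P H S' B' \<kappa>" for \<beta>
  proof -
    define \<beta>' where "\<beta>' = \<beta>(z2 := \<not> \<beta> z1, z3 := \<not> \<beta> z4)"
    obtain \<kappa> where \<kappa>: "\<And>b. b \<in> B \<Longrightarrow> \<kappa> b = \<beta>' b" "suitable P H S B \<kappa>"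
      using state_extend[OF st] by blast
    have \<kappa>z: "\<kappa> z1 \<noteq> \<kappa> z2" "\<kappa> z3 \<noteq> \<kappa> z4"
      using \<kappa>(1) z ne by (auto simp: \<beta>'_def)
    have "bichromatic \<kappa> (V \<inter> P)"
      if V: "wedge V" and V': "V \<inter> (P - S' - B') \<noteq> {} \<or> 3 \<le> card (V \<inter> S')" for V
    \<comment> \<open>A split only moves points from \<open>B\<close> to \<open>S\<close>, so
      \<open>P - S' - B'\<close> equals \<open>P - S - B\<close>. What is new are wedges that reach
      three staircase points through \<open>z2\<close> or \<open>z3\<close>.\<close>
    proof (cases "V \<inter> (P - S - B) \<noteq> {} \<or> 3 \<le> card (V \<inter> S)")
      case True
      with V \<kappa>(2) show ?thesis unfolding suitable_def by blast
    next
      case False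
      then have V3: "3 \<le> card (V \<inter> S')"
        using V' unfolding S'_def B'_def by blast
      have zV: "z2 \<in> V \<or> z3 \<in> V"
      proof (rule ccontr)
        assume "\<not> ?thesis"
        then have "V \<inter> S' = V \<inter> S" unfolding S'_def by blast
        with V3 False show False by simp
      qed
      have "\<not> V \<inter> S' \<subseteq> {z2, z3}"
        using card_mono[of "{z2, z3}" "V \<inter> S'"] V3 ne by auto
      then obtain q where "q \<in> V" "q \<in> S" unfolding S'_def by blast
      then show ?thesis
        using pairs[OF V _ _ zV] \<kappa>z zP unfolding bichromatic_def by blast
    qed
    then have "suitable P H S' B' \<kappa>"
      using \<kappa>(2) unfolding suitable_def by blast
    moreover have "\<forall>b\<in>B'. \<kappa> b = \<beta> b"
      using \<kappa>(1) by (auto simp: B'_def \<beta>'_def)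
    ultimately show ?thesis by blast
  qed
  moreover have "S' \<subseteq> P" "B' \<subseteq> P" "S' \<inter> B' = {}"
    using state_sets[OF st] zP unfolding S'_def B'_def by auto
  moreover have "\<not> below a b" if "a \<in> S' \<union> B'" "b \<in> B'" "a \<noteq> b" for a b
    using anti[of a b] that z unfolding S'_def B'_def by blast
  ultimately have "state P H S' B'"
    using fin by (intro stateI)
  moreover have "card B' < card B"
    by (rule psubset_card_mono) (use fin z in \<open>auto simp: B'_def\<close>)
  ultimately show ?thesis by blast
qed

lemma state_sparse:
  assumes "state P H S B"
  shows "\<exists>S' B'. state P H S' B' \<and> sparse S' B'"
  using assms
proof (induction "card B" arbitrary: S B rule: less_induct)
  case less
  show ?case
  proof (cases "sparse S B")
    case True
    then show ?thesis using less.prems by blast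
  next
    case False
    then obtain W where W: "wedge W" "W \<inter> S = {}" "4 \<le> card (W \<inter> B)"
      unfolding sparse_def by force
    show ?thesis
      using state_split[OF less.prems W] less.hyps by blast
  qed
qed

section \<open>Counting free points in a wedge\<close>

lemma wedge_Int:
  assumes "wedge U" "wedge V"
  shows "wedge (U \<inter> V)"
proof -
  obtain A C A' C' where *: "lower x A" "lower y C" "U = A \<inter> C"
      "lower x A'" "lower y C'" "V = A' \<inter> C'"
    using assms unfolding wedge_def by blast
  then have "lower x (A \<inter> A')" "lower y (C \<inter> C')" unfolding lower_def by auto
  moreover have "U \<inter> V = (A \<inter> A') \<inter> (C \<inter> C')" using * by blast
  ultimately show ?thesis unfolding wedge_def by blast
qed

lemma wedge_x_less: "wedge {i. x i < c}"
  unfolding wedge_def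
  by (rule exI[of _ "{i. x i < c}"], rule exI[of _ UNIV]) (simp add: lower_Collect_less, simp add: lower_def)

lemma wedge_y_less: "wedge {i. y i < c}"
  unfolding wedge_def
  by (rule exI[of _ UNIV], rule exI[of _ "{i. y i < c}"]) (simp add: lower_Collect_less, simp add: lower_def)

text \<open>No free point lies above a staircase point. The part of \<open>V\<close> not above
  either of two staircase points is covered by three wedges missing \<open>S\<close>, each with at
  most three free points.\<close>

lemma card_wedge_le:
  assumes S: "finite S" and B: "finite B" "sparse S B" and V: "wedge V" and V2: "card (V \<inter> S) \<le> 2"
    and anti: "\<And>a b. a \<in> S \<Longrightarrow> b \<in> B \<Longrightarrow> \<not> below a b"
  shows "card (V \<inter> B) \<le> 9"
proof (cases "V \<inter> S = {}")
  case True
  then show ?thesis using B(2) V unfolding sparse_def by fastforce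
next
  case False
  \<comment> \<open>The choice \<open>a = b\<close> covers a single staircase point.\<close>
  have "\<exists>a b. V \<inter> S = {a, b} \<and> x a \<le> x b"
  proof -
    have "card (V \<inter> S) \<noteq> 0"
      using False S by simp
    then have "card (V \<inter> S) = 1 \<or> card (V \<inter> S) = 2"
      using V2 by linarith
    then obtain a b where "V \<inter> S = {a, b}"
      by (metis card_1_singletonE card_2_iff insert_absorb2)
    then show ?thesis by (metis insert_commute linear)
  qed
  then obtain a b where ab: "V \<inter> S = {a, b}" "x a \<le> x b" by blast
  have small: "card (V \<inter> U \<inter> B) \<le> 3" if "wedge U" "a \<notin> U" "b \<notin> U" for U
  proof -
    have "V \<inter> U \<inter> S = {a, b} \<inter> U" unfolding ab(1)[symmetric] by blast
    then have "V \<inter> U \<inter> S = {}" using that by simp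
    then show ?thesis using B(2) wedge_Int[OF V that(1)] unfolding sparse_def by blast
  qed
  \<comment> \<open>The regions are: left of both points, left of \<open>b\<close> and under
    \<open>a\<close>, and under both.\<close>
  define U1 U2 U3 where "U1 = {i. x i < x a}" and "U2 = {i. x i < x b} \<inter> {i. y i < y a}"
    and "U3 = {i. y i < min (y a) (y b)}"
  note U_defs = U1_def U2_def U3_def
  have "wedge U1" "wedge U2" "wedge U3"
    unfolding U_defs by (intro wedge_Int wedge_x_less wedge_y_less)+
  then have le3: "card (V \<inter> U1 \<inter> B) \<le> 3" "card (V \<inter> U2 \<inter> B) \<le> 3" "card (V \<inter> U3 \<inter> B) \<le> 3"
    using ab(2) by (auto intro!: small simp: U_defs)
  have "V \<inter> B \<subseteq> (V \<inter> U1 \<inter> B \<union> V \<inter> U2 \<inter> B) \<union> V \<inter> U3 \<inter> B"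
  proof
    fix p assume p: "p \<in> V \<inter> B"
    then have "\<not> below a p" "\<not> below b p" using anti ab by blast+
    then show "p \<in> (V \<inter> U1 \<inter> B \<union> V \<inter> U2 \<inter> B) \<union> V \<inter> U3 \<inter> B"
      using p unfolding below_def U_defs by auto
  qed
  then have "card (V \<inter> B) \<le> card ((V \<inter> U1 \<inter> B \<union> V \<inter> U2 \<inter> B) \<union> V \<inter> U3 \<inter> B)"
    by (rule card_mono[rotated]) (use B in auto)
  also have "\<dots> \<le> card (V \<inter> U1 \<inter> B) + card (V \<inter> U2 \<inter> B) + card (V \<inter> U3 \<inter> B)"
    by (intro order_trans[OF card_Un_le] add_right_mono card_Un_le)
  finally show ?thesis using le3 by linarith
qed

text \<open>This is where 12 comes from: a monochromatic wedge has at most 2 staircase points, at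
  most 9 free points, and no others.\<close>

lemma sparse_large_wedge:
  assumes st: "state P H S B" and sp: "sparse S B" and \<kappa>: "suitable P H S B \<kappa>"
    and V: "wedge V" and card: "12 \<le> card (V \<inter> P)"
  shows "bichromatic \<kappa> (V \<inter> P)"
proof (rule ccontr)
  assume mono: "\<not> ?thesis"
  have fin: "finite B" "finite S"
    using state_sets[OF st] finite_subset by blast+
  have anti: "\<not> below a b" if "a \<in> S" "b \<in> B" for a b
    using state_antichain[OF st] state_sets(4)[OF st] that by blast
  have "V \<inter> P \<subseteq> V \<inter> S \<union> V \<inter> B"
    using suitable_exceptional[OF \<kappa> V] mono by blast
  then have "card (V \<inter> P) \<le> card (V \<inter> S \<union> V \<inter> B)"
    by (rule card_mono[rotated]) (use fin in auto)
  also have "\<dots> \<le> card (V \<inter> S) + card (V \<inter> B)"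
    by (rule card_Un_le)
  finally have "12 \<le> card (V \<inter> S) + card (V \<inter> B)"
    using card by linarith
  moreover have "card (V \<inter> S) \<le> 2"
    using suitable_card[OF \<kappa> V] mono by linarith
  moreover from this have "card (V \<inter> B) \<le> 9"
    using card_wedge_le[OF fin(2,1) sp V] anti by blast
  ultimately show False by linarith
qed

section \<open>Sweeping along the third coordinate\<close>

lemma state_octants:
  fixes z :: "'a \<Rightarrow> 'd::linorder"
  assumes "finite P"
  shows "\<exists>S B. state P {W \<inter> Z \<inter> P | W Z. wedge W \<and> lower z Z \<and> 12 \<le> card (W \<inter> Z \<inter> P)} S B"
  using assms
proof (induction P rule: finite_ranking_induct[where f = z])
  case empty
  have "state {} {} {} {}" unfolding state_def suitable_def by simp
  then show ?case by auto
next
  case (insert r P)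
  define H where "H P = {W \<inter> Z \<inter> P | W Z. wedge W \<and> lower z Z \<and> 12 \<le> card (W \<inter> Z \<inter> P)}" for P
  show ?case
  \<comment> \<open>The ranking induction orders the insertions by \<open>z\<close> but allows
    \<open>r\<close> to be present already.\<close>
  proof (cases "r \<in> P")
    case True
    then show ?thesis using insert.IH by (simp add: insert_absorb)
  next
    case False
    obtain S B where "state P (H P) S B"
      using insert.IH unfolding H_def by blast
    then have "\<exists>S B. state (insert r P) (H P) S B"
      using state_insert False unfolding H_def by blast
    \<comment> \<open>Sparsity is restored before the history grows, since it is what makes the new
      large wedges bichromatic.\<close>
    then obtain S B where st: "state (insert r P) (H P) S B" and sp: "sparse S B"
      using state_sparse by blast
    have "bichromatic \<kappa> A" if \<kappa>: "suitable (insert r P) (H P) S B \<kappa>" and AH: "A \<in> H (insert r P)" for A \<kappa>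
    proof -
      obtain W Z where A: "A = W \<inter> Z \<inter> insert r P" and W: "wedge W" and Z: "lower z Z"
        and card: "12 \<le> card A"
        using AH unfolding H_def by auto
      show ?thesis
      proof (cases "r \<in> Z")
        case True
        \<comment> \<open>All earlier points have \<open>z\<close> at most \<open>z r\<close>, so
          \<open>Z\<close> contains them and the third coordinate drops out.\<close>
        then have "A = W \<inter> insert r P"
          using Z insert.hyps A unfolding lower_def by blast
        then show ?thesis using sparse_large_wedge[OF st sp \<kappa> W] card by simp
      next
        case False
        \<comment> \<open>Without \<open>r\<close> the set was already recorded at the previous
          moment.\<close>
        then have "A = W \<inter> Z \<inter> P" using A by blast
        then have "A \<in> H P" using W Z card unfolding H_def by blast
        then show ?thesis using \<kappa> by (rule suitable_history[rotated])
      qed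
    qed
    then have suit: "suitable (insert r P) (H (insert r P)) S B \<kappa>"
      if "suitable (insert r P) (H P) S B \<kappa>" for \<kappa>
      using that unfolding suitable_def by blast
    have "\<exists>\<kappa>. (\<forall>b\<in>B. \<kappa> b = \<beta> b) \<and> suitable (insert r P) (H (insert r P)) S B \<kappa>" for \<beta>
      by (rule state_extend[OF st, of \<beta>]) (use suit in auto)
    then have "state (insert r P) (H (insert r P)) S B"
      using state_sets[OF st] state_antichain[OF st] by (intro stateI)
    then show ?thesis unfolding H_def by blast
  qed
qed

end

section \<open>From point colourings back to octant coverings\<close>

lemma two_colouring_octants:
  fixes x :: "'a \<Rightarrow> 'b::linorder" and y :: "'a \<Rightarrow> 'c::linorder" and z :: "'a \<Rightarrow> 'd::linorder"
  assumes "finite P"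
  obtains \<kappa> where "\<And>X Y Z. lower x X \<Longrightarrow> lower y Y \<Longrightarrow> lower z Z \<Longrightarrow>
    12 \<le> card (X \<inter> Y \<inter> Z \<inter> P) \<Longrightarrow> bichromatic \<kappa> (X \<inter> Y \<inter> Z \<inter> P)"
proof -
  interpret planar_points x y .
  obtain S B where st:
    "state P {W \<inter> Z \<inter> P | W Z. wedge W \<and> lower z Z \<and> 12 \<le> card (W \<inter> Z \<inter> P)} S B"
    using state_octants[OF assms] by blast
  obtain \<kappa> where \<kappa>:
    "suitable P {W \<inter> Z \<inter> P | W Z. wedge W \<and> lower z Z \<and> 12 \<le> card (W \<inter> Z \<inter> P)} S B \<kappa>"
    \<comment> \<open>Any colours of the remaining free points will do here.\<close>
    by (rule state_extend[OF st])
  have "bichromatic \<kappa> (X \<inter> Y \<inter> Z \<inter> P)"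
    if "lower x X" "lower y Y" "lower z Z" "12 \<le> card (X \<inter> Y \<inter> Z \<inter> P)" for X Y Z
    by (rule suitable_history[OF \<kappa>]) (use that in \<open>auto simp: wedge_def\<close>)
  then show thesis by (rule that)
qed

text \<open>Duality: for fixed \<open>p\<close>, each inequality defining \<open>p \<in> P i\<close>
  becomes a bound on one coordinate of the index \<open>i\<close>.\<close>

lemma octant_translates_lower:
  fixes Q :: "(real^3) set"
  assumes "octant Q" and "\<And>i. i \<in> I \<Longrightarrow> translate_of Q (P i)"
  obtains f :: "3 \<Rightarrow> 'i \<Rightarrow> real" and L :: "real^3 \<Rightarrow> 3 \<Rightarrow> 'i set"
  where "\<And>p k. lower (f k) (L p k)"
    and "\<And>p i. i \<in> I \<Longrightarrow> p \<in> P i \<longleftrightarrow> (\<forall>k. i \<in> L p k)"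
proof -
  obtain \<epsilon> v :: "real^3" where Q: "Q = (+) v ` {x. \<forall>k. \<epsilon> $ k * x $ k \<le> 0} \<or>
      Q = (+) v ` {x. \<forall>k. \<epsilon> $ k * x $ k < 0}"
    using assms(1) unfolding octant_def by blast
  obtain w where w: "\<And>i. i \<in> I \<Longrightarrow> P i = (+) (w i) ` Q"
    using assms(2) unfolding translate_of_def by metis
  have mem: "p \<in> (+) a ` (+) b ` A \<longleftrightarrow> p - a - b \<in> A" for p a b :: "real^3" and A
    by (auto simp: image_iff algebra_simps) (metis add.commute add_diff_cancel_left' diff_add_cancel)
  \<comment> \<open>This is the apex of \<open>P i\<close>, with signs chosen so that every
    inequality bounds it from above.\<close>
  define f where "f k i = - \<epsilon> $ k * (w i + v) $ k" for k i
  from Q show thesis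
  proof
    assume Q': "Q = (+) v ` {x. \<forall>k. \<epsilon> $ k * x $ k \<le> 0}"
    show thesis
    proof (rule that)
      show "lower (f k) {i. f k i \<le> - \<epsilon> $ k * p $ k}" for k p
        by (rule lower_Collect_le)
      show "p \<in> P i \<longleftrightarrow> (\<forall>k. i \<in> {i. f k i \<le> - \<epsilon> $ k * p $ k})" if "i \<in> I" for p i
        unfolding w[OF that] Q' mem by (simp add: f_def algebra_simps)
    qed
  next
    assume Q': "Q = (+) v ` {x. \<forall>k. \<epsilon> $ k * x $ k < 0}"
    show thesis
    proof (rule that)
      show "lower (f k) {i. f k i < - \<epsilon> $ k * p $ k}" for k p
        by (rule lower_Collect_less)
      show "p \<in> P i \<longleftrightarrow> (\<forall>k. i \<in> {i. f k i < - \<epsilon> $ k * p $ k})" if "i \<in> I" for p i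
        unfolding w[OF that] Q' mem by (simp add: f_def algebra_simps)
    qed
  qed
qed

lemma octant_12_fold_decomposes:
  fixes Q :: "(real^3) set" and I :: "'i set"
  assumes "octant Q" "finite I" "\<And>i. i \<in> I \<Longrightarrow> translate_of Q (P i)" "fold_covering 12 S I P"
  shows "decomposes_into_two_coverings S I P"
proof -
  obtain f :: "3 \<Rightarrow> 'i \<Rightarrow> real" and L where L: "\<And>p k. lower (f k) (L p k)"
    and P: "\<And>p i. i \<in> I \<Longrightarrow> p \<in> P i \<longleftrightarrow> (\<forall>k. i \<in> L p k)"
    by (rule octant_translates_lower[OF assms(1), of I P]) (use assms(3) in auto)
  obtain \<kappa> where \<kappa>: "\<And>X Y Z. lower (f 1) X \<Longrightarrow> lower (f 2) Y \<Longrightarrow> lower (f 3) Z \<Longrightarrow>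
      12 \<le> card (X \<inter> Y \<inter> Z \<inter> I) \<Longrightarrow> bichromatic \<kappa> (X \<inter> Y \<inter> Z \<inter> I)"
    by (rule two_colouring_octants[OF assms(2)]) blast
  have "bichromatic \<kappa> {i \<in> I. p \<in> P i}" if p: "p \<in> S" for p
  proof -
    have eq: "{i \<in> I. p \<in> P i} = L p 1 \<inter> L p 2 \<inter> L p 3 \<inter> I"
      using P by (auto simp: forall_3)
    obtain J where J: "J \<subseteq> I" "card J = 12" "\<forall>j\<in>J. p \<in> P j"
      using assms(4) p unfolding fold_covering_def by blast
    have "card J \<le> card {i \<in> I. p \<in> P i}"
      by (rule card_mono) (use J assms(2) in auto)
    then show ?thesis
      using \<kappa>[OF L L L] J(2) unfolding eq by simp
  qed
  \<comment> \<open>With only two colours, a bichromatic set contains each of them.\<close>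
  then have ex: "\<exists>i\<in>I. p \<in> P i \<and> \<kappa> i = c" if "p \<in> S" for p c
    using that unfolding bichromatic_def by blast
  have "covering S {i \<in> I. \<kappa> i = c} P" for c
    unfolding fold_covering_def
  proof
    fix p assume "p \<in> S"
    then obtain i where "i \<in> I" "p \<in> P i" "\<kappa> i = c" using ex by blast
    then show "\<exists>J\<subseteq>{i \<in> I. \<kappa> i = c}. finite J \<and> card J = 1 \<and> (\<forall>j\<in>J. p \<in> P j)"
      by (intro exI[of _ "{i}"]) simp
  qed
  moreover have "{i \<in> I. \<kappa> i = True} \<union> {i \<in> I. \<kappa> i = False} = I"
    "{i \<in> I. \<kappa> i = True} \<inter> {i \<in> I. \<kappa> i = False} = {}"
    by auto
  ultimately show ?thesis
    unfolding decomposes_into_two_coverings_def by blast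
qed

theorem theorem1:
  fixes Q :: "(real^3) set"
  assumes "octant Q"
  shows "cover_decomposable Q \<and>
    (\<forall>S (I :: 'i set) P. finite I \<longrightarrow> (\<forall>i\<in>I. translate_of Q (P i)) \<longrightarrow>
       fold_covering 12 S I P \<longrightarrow> decomposes_into_two_coverings S I P)"
  unfolding cover_decomposable_def
proof (intro conjI exI[of _ 12] allI impI)
  show "decomposes_into_two_coverings S I P"
    if "finite I" "\<forall>i\<in>I. translate_of Q (P i)" "fold_covering 12 S I P"
    for S and I :: "nat set" and P
    by (rule octant_12_fold_decomposes[OF assms]) (use that in auto)
  show "decomposes_into_two_coverings S I P"
    if "finite I" "\<forall>i\<in>I. translate_of Q (P i)" "fold_covering 12 S I P"
    for S and I :: "'i set" and P
    by (rule octant_12_fold_decomposes[OF assms]) (use that in auto)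
qed

end
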